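(* Let $\phi:\mathcal{S}\to\mathcal{O}$ be a map of species from a species $\mathcal{S}$ into (the underlying species of) an operad $\mathcal{O}$, and let $p:\mathsf{Free}\,\mathcal{S}\to\mathcal{O}$ be the corresponding functor from the free operad. Then the associated lax functor of operads $F:\mathcal{O}\to\mathrm{Span}(\mathrm{Set})$ computing the fibers of $p$ is given by $F_A=\phi^{-1}(A)$ on colors $A$ of $\mathcal{O}$, and by the least family of sets $F_f$ indexed by operations $f:A_1,\dots,A_n\to A$ of $\mathcal{O}$ such that $$F_f\;\cong\;\sum_{\substack{f=\mathrm{id}_A\\ \phi(R)=A}}\mathrm{id}_R\;+\;\sum_{f=g\circ(h_1,\dots,h_k)}\phi^{-1}(g)\bullet(F_{h_1},\dots,F_{h_k}),$$ where $\circ$ is composition in $\mathcal{O}$. For a constant operation $c$ of $\mathcal{O}$ the left summand disappears and this becomes $$F_c\;\cong\;\sum_{c=g\circ(c_1,\dots,c_k)}\phi^{-1}(g)\bullet(F_{c_1},\dots,F_{c_k}).$$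
   Context: "Operad" means colored non-symmetric operad (multicategory). A species consists of a set $C$ of colors, a set $V$ of nodes, and functions $i:V\to C^*$ (input colors), $o:V\to C$ (output color); write $x:R_1,\dots,R_n\to R$ for a node. A map of species $\phi$ is a pair of functions on colors and nodes (both written $\phi$) sending each node $x:R_1,\dots,R_n\to R$ to a node $\phi(x):\phi(R_1),\dots,\phi(R_n)\to\phi(R)$. Every operad has an underlying species whose nodes are its operations; $\mathsf{Free}$ denotes the left adjoint of the resulting forgetful functor from operads to species. Maps of species $\phi:\mathcal{S}\to\mathcal{O}$ correspond to functors of operads $p:\mathsf{Free}\,\mathcal{S}\to\mathcal{O}$. Fibers. For a functor of operads $p:\mathcal{D}\to\mathcal{O}$, the associated lax functor $F:\mathcal{O}\to\mathrm{Span}(\mathrm{Set})$ assigns to each color $A$ the set $F_A=p^{-1}(A)$ of colors of $\mathcal{D}$ over $A$, and to each operation $f:A_1,\dots,A_n\to A$ the set $F_f=p^{-1}(f)$ of operations of $\mathcal{D}$ over $f$, regarded as a multi-legged span with legs $F_f\to F_{A_1},\dots,F_f\to F_{A_n}$ and $F_f\to F_A$ given by the input and output colors; its lax structure maps are given by composition and identities in $\mathcal{D}$. Notation in the formula. The first sum is over colors $R$ of $\mathcal{S}$ with $\phi(R)=A$, present only when $f=\mathrm{id}_A$, and contributes one element $\mathrm{id}_R$ (with both legs $R$) for each. The second sum is over all ways of writing $f=g\circ(h_1,\dots,h_k)$, $k\ge 0$, in $\mathcal{O}$; $\phi^{-1}(g)\bullet(F_{h_1},\dots,F_{h_k})$ is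 the set of formal composites $x\bullet(\alpha_1,\dots,\alpha_k)$ of a node $x:R_1,\dots,R_k\to R$ of $\mathcal{S}$ with $\phi(x)=g$ and elements $\alpha_i\in F_{h_i}$ with output color $R_i$; its output color is $R$ and its list of input colors is the concatenation of those of the $\alpha_i$. Under the isomorphism, $x\bullet(\alpha_1,\dots,\alpha_k)$ corresponds to the composite $x\circ(\alpha_1,\dots,\alpha_k)$ in $\mathsf{Free}\,\mathcal{S}$. "Least family" means the initial algebra of the endofunctor given by the right-hand side on families $(X_f)_f$ of multi-legged spans over the sets $F_A=\phi^{-1}(A)$. *)

theory Defs
  imports Main
begin

section \<open>Species and operads\<close>

record ('c, 'v) species =
  colors :: "'c set"
  nodes :: "'v set"
  incolors :: "'v \<Rightarrow> 'c list"
  outcolor :: "'v \<Rightarrow> 'c"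

text \<open>
  Operads are colored and non-symmetric.  The record extends that of species: the operations of an
  operad are its nodes, so the underlying species of an operad is the operad itself, seen through
  the fields of species.
\<close>

record ('c, 'v) operad = "('c, 'v) species" +
  oid :: "'c \<Rightarrow> 'v"
  ocomp :: "'v \<Rightarrow> 'v list \<Rightarrow> 'v"

locale species =
  fixes S :: "('c, 'v, 'z) species_scheme"
  assumes inputs_closed: "x \<in> nodes S \<Longrightarrow> set (incolors S x) \<subseteq> colors S"
    and output_closed: "x \<in> nodes S \<Longrightarrow> outcolor S x \<in> colors S"

definition composable :: "('c, 'v, 'z) species_scheme \<Rightarrow> 'v \<Rightarrow> 'v list \<Rightarrow> bool" where
  "composable P g hs \<longleftrightarrow>
     g \<in> nodes P \<and> set hs \<subseteq> nodes P \<and> map (outcolor P) hs = incolors P g"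

locale operad = species P for P :: "('c, 'v) operad" +
  assumes oid_closed: "A \<in> colors P \<Longrightarrow> oid P A \<in> nodes P"
    and inputs_oid: "A \<in> colors P \<Longrightarrow> incolors P (oid P A) = [A]"
    and output_oid: "A \<in> colors P \<Longrightarrow> outcolor P (oid P A) = A"
    and ocomp_closed: "composable P g hs \<Longrightarrow> ocomp P g hs \<in> nodes P"
    and inputs_ocomp: "composable P g hs \<Longrightarrow> incolors P (ocomp P g hs) = concat (map (incolors P) hs)"
    and output_ocomp: "composable P g hs \<Longrightarrow> outcolor P (ocomp P g hs) = outcolor P g"
    and ocomp_oid_left: "g \<in> nodes P \<Longrightarrow> ocomp P (oid P (outcolor P g)) [g] = g"
    and ocomp_oid_right: "g \<in> nodes P \<Longrightarrow> ocomp P g (map (oid P) (incolors P g)) = g"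
    and ocomp_assoc:
      "\<lbrakk>composable P f gs; list_all2 (composable P) gs hss\<rbrakk> \<Longrightarrow>
       ocomp P (ocomp P f gs) (concat hss) = ocomp P f (map2 (ocomp P) gs hss)"

text \<open>
  A map is given by a function on colors and a function on nodes.  Only their values on the
  carriers are meaningful.
\<close>

locale species_map = S: species S + T: species T
  for S :: "('c, 'v, 'y) species_scheme" and T :: "('d, 'w, 'z) species_scheme" +
  fixes phiC :: "'c \<Rightarrow> 'd" and phiV :: "'v \<Rightarrow> 'w"
  assumes colors_map: "R \<in> colors S \<Longrightarrow> phiC R \<in> colors T"
    and nodes_map: "x \<in> nodes S \<Longrightarrow> phiV x \<in> nodes T"
    and inputs_map: "x \<in> nodes S \<Longrightarrow> incolors T (phiV x) = map phiC (incolors S x)"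
    and output_map: "x \<in> nodes S \<Longrightarrow> outcolor T (phiV x) = phiC (outcolor S x)"

locale operad_functor = D: operad D + P: operad P + species_map D P pC pV
  for D :: "('d, 'p) operad" and P :: "('a, 'f) operad" and pC pV +
  assumes oid_map: "A \<in> colors D \<Longrightarrow> pV (oid D A) = oid P (pC A)"
    and ocomp_map: "composable D g hs \<Longrightarrow> pV (ocomp D g hs) = ocomp P (pV g) (map pV hs)"


section \<open>Free operads\<close>

definition extends_along ::
  "('c, 'v, 'z) species_scheme \<Rightarrow> ('c \<Rightarrow> 'd) \<Rightarrow> ('v \<Rightarrow> 'p) \<Rightarrow> ('d \<Rightarrow> 'e) \<Rightarrow> ('p \<Rightarrow> 'g) \<Rightarrow>
   ('c \<Rightarrow> 'e) \<Rightarrow> ('v \<Rightarrow> 'g) \<Rightarrow> bool" where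
  "extends_along S etaC etaV qC qV phiC phiV \<longleftrightarrow>
     (\<forall>R\<in>colors S. qC (etaC R) = phiC R) \<and> (\<forall>x\<in>nodes S. qV (etaV x) = phiV x)"

text \<open>
  The universal property of the unit of the adjunction between species and operads, tested against
  the operads with colors in \<open>'e\<close> and operations in \<open>'g\<close>.
\<close>

definition universal_at ::
  "('e, 'g) operad itself \<Rightarrow> ('c, 'v) species \<Rightarrow> ('d, 'p) operad \<Rightarrow> ('c \<Rightarrow> 'd) \<Rightarrow> ('v \<Rightarrow> 'p) \<Rightarrow> bool"
  where
  "universal_at T S D etaC etaV \<longleftrightarrow>
     operad D \<and> species_map S D etaC etaV \<and>
     (\<forall>(E :: ('e, 'g) operad) phiC phiV. operad E \<and> species_map S E phiC phiV \<longrightarrow>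
        (\<exists>qC qV. operad_functor D E qC qV \<and> extends_along S etaC etaV qC qV phiC phiV \<and>
           (\<forall>rC rV. operad_functor D E rC rV \<and> extends_along S etaC etaV rC rV phiC phiV \<longrightarrow>
              (\<forall>A\<in>colors D. rC A = qC A) \<and> (\<forall>f\<in>nodes D. rV f = qV f))))"

text \<open>
  A concrete operad of trees.  It serves to fix the size of the universes in the definition of free
  operads, and as witness for their existence.
\<close>

datatype ('c, 'v) tree = Leaf 'c | Node 'v "('c, 'v) tree list"

primrec leaves :: "('c, 'v) tree \<Rightarrow> 'c list" where
  "leaves (Leaf R) = [R]"
| "leaves (Node x ts) = concat (map leaves ts)"

primrec root :: "('c, 'v) species \<Rightarrow> ('c, 'v) tree \<Rightarrow> 'c" where
  "root S (Leaf R) = R"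
| "root S (Node x ts) = outcolor S x"

primrec wf_tree :: "('c, 'v) species \<Rightarrow> ('c, 'v) tree \<Rightarrow> bool" where
  "wf_tree S (Leaf R) \<longleftrightarrow> R \<in> colors S"
| "wf_tree S (Node x ts) \<longleftrightarrow>
     x \<in> nodes S \<and> list_all (wf_tree S) ts \<and> map (root S) ts = incolors S x"

fun chunks :: "nat list \<Rightarrow> 'a list \<Rightarrow> 'a list list" where
  "chunks [] us = []"
| "chunks (n # ns) us = take n us # chunks ns (drop n us)"

primrec graft :: "('c, 'v) tree \<Rightarrow> ('c, 'v) tree list \<Rightarrow> ('c, 'v) tree" where
  "graft (Leaf R) us = hd us"
| "graft (Node x ts) us =
     Node x (map2 (\<lambda>f vs. f vs) (map graft ts) (chunks (map (length \<circ> leaves) ts) us))"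

definition tree_operad :: "('c, 'v) species \<Rightarrow> ('c, ('c, 'v) tree) operad" where
  "tree_operad S =
     \<lparr>colors = colors S, nodes = {t. wf_tree S t}, incolors = leaves, outcolor = root S,
      oid = Leaf, ocomp = graft\<rparr>"

definition corolla :: "('c, 'v) species \<Rightarrow> 'v \<Rightarrow> ('c, 'v) tree" where
  "corolla S x = Node x (map Leaf (incolors S x))"

text \<open>
  \<open>free_operad S D etaC etaV\<close>: the operad \<open>D\<close> together with the map of species
  \<open>(etaC, etaV)\<close> is the value at \<open>S\<close> of the left adjoint to the forgetful functor.
  As one cannot quantify over types inside a formula, the universal property is required for two
  types of operads only: that of \<open>D\<close> and that of the operad of trees.  This entails the universal
  property for operads over all types: see \<open>free_operad_universal\<close> below.
\<close>

definition free_operad ::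
  "('c, 'v) species \<Rightarrow> ('d, 'p) operad \<Rightarrow> ('c \<Rightarrow> 'd) \<Rightarrow> ('v \<Rightarrow> 'p) \<Rightarrow> bool" where
  "free_operad S D etaC etaV \<longleftrightarrow>
     universal_at TYPE(('d, 'p) operad) S D etaC etaV \<and>
     universal_at TYPE(('c, ('c, 'v) tree) operad) S D etaC etaV"

subsection \<open>The operad of trees is an operad\<close>

lemma chunks_concat:
  "list_all2 (\<lambda>n us. length us = n) ns uss \<Longrightarrow> chunks ns (concat uss) = uss"
  by (induction rule: list_all2_induct) auto

lemma map_eq_concat:
  "map f us = concat (map g ts) \<Longrightarrow>
   \<exists>uss. us = concat uss \<and> list_all2 (\<lambda>t us. map f us = g t) ts uss"
proof (induction ts arbitrary: us)
  case (Cons t ts)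
  then obtain vs ws where "us = vs @ ws" "map f vs = g t" "map f ws = concat (map g ts)"
    by (auto simp: map_eq_append_conv)
  moreover obtain uss where "ws = concat uss" "list_all2 (\<lambda>t us. map f us = g t) ts uss"
    using Cons.IH calculation(3) by blast
  ultimately show ?case by (intro exI[of _ "vs # uss"]) simp
qed simp

lemma graft_Node:
  assumes "list_all2 (\<lambda>t us. length us = length (leaves t)) ts uss"
  shows "graft (Node x ts) (concat uss) = Node x (map2 graft ts uss)"
proof -
  have "chunks (map (length \<circ> leaves) ts) (concat uss) = uss"
    using assms by (intro chunks_concat) (simp add: list_all2_map1)
  moreover have "map2 (\<lambda>f vs. f vs) (map graft ts) uss = map2 graft ts uss"
    using list_all2_lengthD[OF assms] by (intro nth_equalityI) simp_all
  ultimately show ?thesis by (simp only: graft.simps)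
qed

lemma composable_tree:
  "composable (tree_operad S) t us \<longleftrightarrow>
     wf_tree S t \<and> list_all (wf_tree S) us \<and> map (root S) us = leaves t"
  by (auto simp: composable_def tree_operad_def list_all_iff)

lemma composable_Node:
  assumes "composable (tree_operad S) (Node x ts) us"
  obtains uss where "us = concat uss" "list_all2 (composable (tree_operad S)) ts uss"
    "x \<in> nodes S" "map (root S) ts = incolors S x"
    "list_all2 (\<lambda>t us. length us = length (leaves t)) ts uss"
proof -
  have *: "x \<in> nodes S" "map (root S) ts = incolors S x" "list_all (wf_tree S) ts"
    "list_all (wf_tree S) us" "map (root S) us = concat (map leaves ts)"
    using assms by (auto simp: composable_tree)
  obtain uss where uss: "us = concat uss" "list_all2 (\<lambda>t us. map (root S) us = leaves t) ts uss"
    using map_eq_concat[OF *(5)] by blast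
  have "list_all2 (composable (tree_operad S)) ts uss"
    using uss *(3,4)
    by (auto simp: list_all2_conv_all_nth composable_tree list_all_iff)
  moreover have "list_all2 (\<lambda>t us. length us = length (leaves t)) ts uss"
    using uss(2) by (rule list_all2_mono) (auto dest: arg_cong[where f = length])
  ultimately show ?thesis using that[OF uss(1)] *(1,2) by blast
qed

lemma nth_zip_mem: "i < length xs \<Longrightarrow> length xs = length ys \<Longrightarrow> (xs ! i, ys ! i) \<in> set (zip xs ys)"
  by (auto simp: set_zip)

lemma concat_map_concat: "concat (map concat xsss) = concat (concat xsss)"
  by (induction xsss) auto

lemma graft_wf:
  "composable (tree_operad S) t us \<Longrightarrow>
   wf_tree S (graft t us) \<and> root S (graft t us) = root S t \<and>
   leaves (graft t us) = concat (map leaves us)"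
proof (induction t arbitrary: us)
  case (Leaf R)
  then show ?case by (auto simp: composable_tree)
next
  case (Node x ts)
  obtain uss where uss: "us = concat uss" "list_all2 (composable (tree_operad S)) ts uss"
    "x \<in> nodes S" "map (root S) ts = incolors S x"
    "list_all2 (\<lambda>t us. length us = length (leaves t)) ts uss"
    using composable_Node[OF Node.prems] by blast
  have g: "graft (Node x ts) us = Node x (map2 graft ts uss)"
    using graft_Node uss by simp
  have IH: "wf_tree S (graft t vs) \<and> root S (graft t vs) = root S t \<and>
     leaves (graft t vs) = concat (map leaves vs)" if "(t, vs) \<in> set (zip ts uss)" for t vs
    using Node.IH[of t vs] uss(2) that by (auto simp: list_all2_iff dest: set_zip_leftD)
  have len: "length ts = length uss" using uss(2) by (simp add: list_all2_lengthD)
  have nth: "root S (graft (ts ! i) (uss ! i)) = root S (ts ! i)"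
    "leaves (graft (ts ! i) (uss ! i)) = concat (map leaves (uss ! i))" if "i < length ts" for i
    using IH[OF nth_zip_mem[OF that len]] by auto
  have "list_all (wf_tree S) (map2 graft ts uss)"
    using IH by (auto simp: list_all_iff)
  moreover have "map (root S) (map2 graft ts uss) = map (root S) ts"
    using nth(1) len by (intro nth_equalityI) simp_all
  moreover have "map leaves (map2 graft ts uss) = map (\<lambda>us. concat (map leaves us)) uss"
    using nth(2) len by (intro nth_equalityI) simp_all
  moreover have "concat (map (\<lambda>us. concat (map leaves us)) uss) = concat (map leaves (concat uss))"
    by (induction uss) auto
  ultimately show ?case
    unfolding g by (simp only: uss wf_tree.simps root.simps leaves.simps simp_thms)
qed

lemma graft_Leaf_right: "graft t (map Leaf (leaves t)) = t"
proof (induction t)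
  case (Node x ts)
  have "graft (Node x ts) (concat (map (map Leaf \<circ> leaves) ts)) =
      Node x (map2 graft ts (map (map Leaf \<circ> leaves) ts))"
    by (rule graft_Node) (simp add: list_all2_conv_all_nth)
  also have "map2 graft ts (map (map Leaf \<circ> leaves) ts) = ts"
    using Node by (auto intro!: nth_equalityI)
  finally show ?case by (simp add: map_concat comp_def del: graft.simps)
qed simp

lemma map2_concat:
  "list_all2 (\<lambda>xs ys. length xs = length ys) xss yss \<Longrightarrow>
   map2 f (concat xss) (concat yss) = concat (map2 (map2 f) xss yss)"
  by (induction rule: list_all2_induct) auto

lemma list_all2_concat_left:
  "list_all2 Q (concat xss) ys \<Longrightarrow> \<exists>yss. ys = concat yss \<and> list_all2 (list_all2 Q) xss yss"
proof (induction xss arbitrary: ys)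
  case (Cons xs xss)
  then obtain as bs where "ys = as @ bs" "list_all2 Q xs as" "list_all2 Q (concat xss) bs"
    by (auto simp: list_all2_append1)
  moreover obtain yss where "bs = concat yss" "list_all2 (list_all2 Q) xss yss"
    using Cons.IH calculation(3) by blast
  ultimately show ?case by (intro exI[of _ "as # yss"]) simp
qed simp

lemma graft_assoc:
  "composable (tree_operad S) t us \<Longrightarrow> list_all2 (composable (tree_operad S)) us vss \<Longrightarrow>
   graft (graft t us) (concat vss) = graft t (map2 graft us vss)"
proof (induction t arbitrary: us vss)
  case (Leaf R)
  then show ?case by (cases us) (auto simp: composable_tree list_all2_Cons1)
next
  case (Node x ts)
  obtain uss where uss: "us = concat uss" "list_all2 (composable (tree_operad S)) ts uss"
    "list_all2 (\<lambda>t us. length us = length (leaves t)) ts uss"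
    using composable_Node[OF Node.prems(1)] by blast
  obtain vsss where vsss: "vss = concat vsss"
    "list_all2 (list_all2 (composable (tree_operad S))) uss vsss"
    using list_all2_concat_left Node.prems(2) uss(1) by blast
  have len: "length ts = length uss" "length vsss = length uss"
    using uss(2) vsss(2) by (auto simp: list_all2_lengthD)
  have nth: "composable (tree_operad S) (ts ! i) (uss ! i)"
    "list_all2 (composable (tree_operad S)) (uss ! i) (vsss ! i)"
    "length (uss ! i) = length (leaves (ts ! i))" if "i < length ts" for i
    using uss vsss len that by (auto simp: list_all2_conv_all_nth)
  have lv: "length (concat ws) = length (concat (map leaves vs))"
    if "list_all2 (composable (tree_operad S)) vs ws" for vs ws
    using that by (induction rule: list_all2_induct)
      (auto simp: composable_tree dest: arg_cong[where f = length])
  have "graft (Node x ts) us = Node x (map2 graft ts uss)"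
    using graft_Node uss by simp
  then have "graft (graft (Node x ts) us) (concat vss) =
      graft (Node x (map2 graft ts uss)) (concat (map concat vsss))"
    by (simp only: vsss(1) concat_map_concat)
  also have "\<dots> = Node x (map2 graft (map2 graft ts uss) (map concat vsss))"
  proof (intro graft_Node list_all2_all_nthI)
    fix i assume "i < length (map2 graft ts uss)"
    then have i: "i < length ts" using len by simp
    then show "length (map concat vsss ! i) = length (leaves (map2 graft ts uss ! i))"
      using len lv[OF nth(2)[OF i]] graft_wf[OF nth(1)[OF i]]
      by simp
  qed (use len in simp)
  also have "map2 graft (map2 graft ts uss) (map concat vsss) =
      map2 graft ts (map2 (map2 graft) uss vsss)"
    using len Node.IH[OF nth_mem nth(1,2)] by (intro nth_equalityI) simp_all
  also have "Node x \<dots> = graft (Node x ts) (concat (map2 (map2 graft) uss vsss))"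
    using len nth(2,3)
    by (intro graft_Node[symmetric] list_all2_all_nthI) (simp_all add: list_all2_lengthD[OF nth(2)])
  also have "concat (map2 (map2 graft) uss vsss) = map2 graft us vss"
    unfolding uss(1) vsss(1) using vsss(2)
    by (intro map2_concat[symmetric]) (auto elim!: list_all2_mono dest: list_all2_lengthD)
  finally show ?case .
qed

lemma wf_tree_colors:
  fixes S :: "('c, 'v) species"
  assumes "species S"
  shows "wf_tree S t \<Longrightarrow> set (leaves t) \<subseteq> colors S \<and> root S t \<in> colors S"
  by (induction t) (auto simp: list_all_iff dest: species.output_closed[OF assms])

lemma operad_tree_operad:
  fixes S :: "('c, 'v) species"
  assumes "species S"
  shows "operad (tree_operad S)"
proof -
  interpret species S by fact
  have colors: "set (leaves t) \<subseteq> colors S \<and> root S t \<in> colors S" if "wf_tree S t" for t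
    using wf_tree_colors[OF assms that] .
  show ?thesis
  proof
    fix g hs assume c: "composable (tree_operad S) g hs"
    show "ocomp (tree_operad S) g hs \<in> nodes (tree_operad S)"
      "incolors (tree_operad S) (ocomp (tree_operad S) g hs) =
         concat (map (incolors (tree_operad S)) hs)"
      "outcolor (tree_operad S) (ocomp (tree_operad S) g hs) = outcolor (tree_operad S) g"
      using graft_wf[OF c] by (auto simp: tree_operad_def)
  next
    fix f gs hss
    assume c: "composable (tree_operad S) f gs" "list_all2 (composable (tree_operad S)) gs hss"
    show "ocomp (tree_operad S) (ocomp (tree_operad S) f gs) (concat hss) =
        ocomp (tree_operad S) f (map2 (ocomp (tree_operad S)) gs hss)"
      using graft_assoc[OF c] by (simp add: tree_operad_def)
  qed (use colors in \<open>auto simp: tree_operad_def graft_Leaf_right\<close>)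
qed

lemma species_map_corolla:
  fixes S :: "('c, 'v) species"
  assumes "species S"
  shows "species_map S (tree_operad S) id (corolla S)"
proof -
  interpret species S by fact
  interpret T: operad "tree_operad S" using assms by (rule operad_tree_operad)
  show ?thesis
    by unfold_locales
      (auto simp: tree_operad_def corolla_def list_all_iff comp_def dest: inputs_closed
        intro!: map_idI)
qed

subsection \<open>The operad of trees is free\<close>

primrec eval_tree :: "('e, 'g) operad \<Rightarrow> ('c \<Rightarrow> 'e) \<Rightarrow> ('v \<Rightarrow> 'g) \<Rightarrow> ('c, 'v) tree \<Rightarrow> 'g" where
  "eval_tree E phiC phiV (Leaf R) = oid E (phiC R)"
| "eval_tree E phiC phiV (Node x ts) = ocomp E (phiV x) (map (eval_tree E phiC phiV) ts)"

lemma eval_tree_typed: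
  fixes S :: "('c, 'v) species" and E :: "('e, 'g) operad"
  assumes "operad E" "species_map S E phiC phiV"
  shows "wf_tree S t \<Longrightarrow>
     eval_tree E phiC phiV t \<in> nodes E \<and>
     incolors E (eval_tree E phiC phiV t) = map phiC (leaves t) \<and>
     outcolor E (eval_tree E phiC phiV t) = phiC (root S t)"
proof -
  interpret E: operad E by fact
  interpret species_map S E phiC phiV by fact
  show "wf_tree S t \<Longrightarrow>
     eval_tree E phiC phiV t \<in> nodes E \<and>
     incolors E (eval_tree E phiC phiV t) = map phiC (leaves t) \<and>
     outcolor E (eval_tree E phiC phiV t) = phiC (root S t)"
  proof (induction t)
    case (Leaf R)
    then show ?case by (simp add: colors_map E.oid_closed E.inputs_oid E.output_oid)
  next
    case (Node x ts)
    let ?e = "eval_tree E phiC phiV"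
    have IH: "?e t \<in> nodes E \<and> incolors E (?e t) = map phiC (leaves t) \<and> outcolor E (?e t) = phiC (root S t)"
      if "t \<in> set ts" for t
      using Node that by (auto simp: list_all_iff)
    have x: "x \<in> nodes S" and r: "map (root S) ts = incolors S x" using Node.prems by auto
    have "map (\<lambda>t. outcolor E (?e t)) ts = map (\<lambda>t. phiC (root S t)) ts" using IH by simp
    also have "\<dots> = incolors E (phiV x)" using x by (simp add: inputs_map r[symmetric])
    finally have c: "composable E (phiV x) (map ?e ts)"
      using x IH by (auto simp: composable_def nodes_map comp_def)
    have "map (\<lambda>t. incolors E (?e t)) ts = map (\<lambda>t. map phiC (leaves t)) ts" using IH by simp
    then have "concat (map (incolors E) (map ?e ts)) = map phiC (concat (map leaves ts))"
      by (simp add: map_concat comp_def del: map_eq_conv)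
    then show ?case using x
      by (simp add: E.ocomp_closed[OF c] E.inputs_ocomp[OF c] E.output_ocomp[OF c] output_map
          del: map_map)
  qed
qed

lemma eval_tree_graft:
  fixes S :: "('c, 'v) species" and E :: "('e, 'g) operad"
  assumes E: "operad E" and phi: "species_map S E phiC phiV"
  shows "composable (tree_operad S) t us \<Longrightarrow>
     eval_tree E phiC phiV (graft t us) =
     ocomp E (eval_tree E phiC phiV t) (map (eval_tree E phiC phiV) us)"
proof (induction t arbitrary: us)
  case (Leaf R)
  interpret E: operad E by fact
  from Leaf obtain u where "us = [u]" "wf_tree S u" "root S u = R"
    by (cases us) (auto simp: composable_tree)
  then show ?case
    using eval_tree_typed[OF assms, of u] E.ocomp_oid_left[of "eval_tree E phiC phiV u"] by auto
next
  case (Node x ts)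
  interpret E: operad E by fact
  interpret species_map S E phiC phiV by fact
  let ?e = "eval_tree E phiC phiV"
  note typed = eval_tree_typed[OF assms]
  have comp: "composable E (?e t) (map ?e us)" if "composable (tree_operad S) t us" for t us
  proof -
    have t: "wf_tree S t" "\<forall>u\<in>set us. wf_tree S u" "map (root S) us = leaves t"
      using that by (simp_all add: composable_tree list_all_iff)
    have "map (outcolor E) (map ?e us) = map phiC (map (root S) us)"
      using t(2) typed by simp
    then have "map (outcolor E) (map ?e us) = incolors E (?e t)"
      using t(1) typed by (simp only: t(3))
    then show ?thesis
      using t typed by (auto simp only: composable_def set_map)
  qed
  obtain uss where uss: "us = concat uss" "list_all2 (composable (tree_operad S)) ts uss"
    "x \<in> nodes S" "map (root S) ts = incolors S x"
    "list_all2 (\<lambda>t us. length us = length (leaves t)) ts uss"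
    using composable_Node[OF Node.prems] by blast
  have wf: "wf_tree S t" if "t \<in> set ts" for t
    using Node.prems that by (auto simp: composable_tree list_all_iff)
  have "map (outcolor E) (map ?e ts) = map phiC (map (root S) ts)"
    using typed wf by auto
  also have "\<dots> = incolors E (phiV x)"
    using uss(3,4) by (simp add: inputs_map)
  finally have c1: "composable E (phiV x) (map ?e ts)"
    using typed wf uss(3) by (auto simp: composable_def nodes_map)
  have c2: "list_all2 (composable E) (map ?e ts) (map (map ?e) uss)"
    using uss(2) comp by (auto simp: list_all2_conv_all_nth)
  have "?e (graft (Node x ts) us) = ?e (Node x (map2 graft ts uss))"
    by (simp only: uss(1) graft_Node[OF uss(5)])
  also have "\<dots> = ocomp E (phiV x) (map ?e (map2 graft ts uss))" by simp
  also have "map ?e (map2 graft ts uss) = map2 (ocomp E) (map ?e ts) (map (map ?e) uss)"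
    using uss(2) Node.IH by (auto intro!: nth_equalityI simp: list_all2_conv_all_nth)
  also have "ocomp E (phiV x) \<dots> = ocomp E (?e (Node x ts)) (map ?e us)"
    using E.ocomp_assoc[OF c1 c2] uss(1) by (simp add: map_concat)
  finally show ?case .
qed

lemma operad_functor_eval_tree:
  fixes S :: "('c, 'v) species" and E :: "('e, 'g) operad"
  assumes E: "operad E" and phi: "species_map S E phiC phiV"
  shows "operad_functor (tree_operad S) E phiC (eval_tree E phiC phiV)"
    and "extends_along S id (corolla S) phiC (eval_tree E phiC phiV) phiC phiV"
proof -
  interpret E: operad E by fact
  interpret species_map S E phiC phiV by fact
  interpret T: operad "tree_operad S" by (rule operad_tree_operad) unfold_locales
  note typed = eval_tree_typed[OF assms]
  show "operad_functor (tree_operad S) E phiC (eval_tree E phiC phiV)"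
  proof unfold_locales
    fix g hs assume "composable (tree_operad S) g hs"
    then show "eval_tree E phiC phiV (ocomp (tree_operad S) g hs) =
        ocomp E (eval_tree E phiC phiV g) (map (eval_tree E phiC phiV) hs)"
      using eval_tree_graft[OF assms, of g hs] by (simp add: tree_operad_def)
  qed (auto simp: tree_operad_def typed colors_map)
  have "ocomp E (phiV x) (map (oid E \<circ> phiC) (incolors S x)) = phiV x" if "x \<in> nodes S" for x
    using E.ocomp_oid_right[OF nodes_map[OF that]] that by (simp add: inputs_map)
  then show "extends_along S id (corolla S) phiC (eval_tree E phiC phiV) phiC phiV"
    by (simp add: extends_along_def corolla_def comp_def)
qed

lemma tree_functor_unique:
  fixes S :: "('c, 'v) species" and E :: "('e, 'g) operad"
  assumes S: "species S" and q: "operad_functor (tree_operad S) E qC qV"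
    and ext: "extends_along S id (corolla S) qC qV phiC phiV"
  shows "wf_tree S t \<Longrightarrow> qV t = eval_tree E phiC phiV t"
proof (induction t)
  case (Leaf R)
  interpret operad_functor "tree_operad S" E qC qV by fact
  show ?case using Leaf ext oid_map[of R] by (simp add: tree_operad_def extends_along_def)
next
  case (Node x ts)
  interpret operad_functor "tree_operad S" E qC qV by fact
  interpret C: species_map S "tree_operad S" id "corolla S"
    using S by (rule species_map_corolla)
  have x: "x \<in> nodes S" using Node.prems by simp
  have c: "composable (tree_operad S) (corolla S x) ts"
    using Node.prems C.nodes_map[OF x]
    by (simp add: composable_tree) (simp add: corolla_def comp_def tree_operad_def)
  have "graft (corolla S x) (concat (map (\<lambda>t. [t]) ts)) =
      Node x (map2 graft (map Leaf (incolors S x)) (map (\<lambda>t. [t]) ts))"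
    unfolding corolla_def using Node.prems
    by (intro graft_Node) (auto simp: list_all2_conv_all_nth dest: arg_cong[where f = length])
  also have "map2 graft (map Leaf (incolors S x)) (map (\<lambda>t. [t]) ts) = ts"
    using Node.prems by (auto intro!: nth_equalityI dest: arg_cong[where f = length])
  finally have "Node x ts = ocomp (tree_operad S) (corolla S x) ts"
    by (simp add: tree_operad_def)
  then have "qV (Node x ts) = ocomp E (qV (corolla S x)) (map qV ts)"
    using ocomp_map[OF c] by simp
  also have "map qV ts = map (eval_tree E phiC phiV) ts"
    using Node by (auto simp: list_all_iff)
  finally show ?case using ext x by (simp add: extends_along_def)
qed

theorem universal_at_tree_operad:
  fixes S :: "('c, 'v) species"
  assumes "species S"
  shows "universal_at TYPE(('e, 'g) operad) S (tree_operad S) id (corolla S)"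
  unfolding universal_at_def
proof (intro conjI allI impI)
  show "operad (tree_operad S)" using assms by (rule operad_tree_operad)
  show "species_map S (tree_operad S) id (corolla S)" using assms by (rule species_map_corolla)
  fix E :: "('e, 'g) operad" and phiC phiV
  assume *: "operad E \<and> species_map S E phiC phiV"
  have "(\<forall>A\<in>colors (tree_operad S). rC A = phiC A) \<and>
      (\<forall>f\<in>nodes (tree_operad S). rV f = eval_tree E phiC phiV f)"
    if "operad_functor (tree_operad S) E rC rV \<and> extends_along S id (corolla S) rC rV phiC phiV"
    for rC rV
    using that tree_functor_unique[OF assms, of E rC rV phiC phiV]
    by (auto simp: tree_operad_def extends_along_def)
  then show "\<exists>qC qV. operad_functor (tree_operad S) E qC qV \<and>
      extends_along S id (corolla S) qC qV phiC phiV \<and>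
      (\<forall>rC rV. operad_functor (tree_operad S) E rC rV \<and>
         extends_along S id (corolla S) rC rV phiC phiV \<longrightarrow>
         (\<forall>A\<in>colors (tree_operad S). rC A = qC A) \<and> (\<forall>f\<in>nodes (tree_operad S). rV f = qV f))"
    using operad_functor_eval_tree * by blast
qed

corollary free_operad_tree_operad:
  "species S \<Longrightarrow> free_operad S (tree_operad S) id (corolla S)"
  by (simp add: free_operad_def universal_at_tree_operad)

lemma operad_functor_id: "operad D \<Longrightarrow> operad_functor D D id id"
  unfolding operad_functor_def operad_functor_axioms_def species_map_def species_map_axioms_def
  by (simp add: operad_def)

lemma operad_functor_comp:
  assumes "operad_functor D E qC qV" "operad_functor E G rC rV"
  shows "operad_functor D G (rC \<circ> qC) (rV \<circ> qV)"
proof -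
  interpret q: operad_functor D E qC qV by fact
  interpret r: operad_functor E G rC rV by fact
  have comp: "composable E (qV g) (map qV hs)" if "composable D g hs" for g hs
  proof -
    have "map (outcolor E \<circ> qV) hs = map (qC \<circ> outcolor D) hs"
      using that by (auto simp: composable_def q.output_map)
    also have "\<dots> = incolors E (qV g)"
      using that by (simp add: composable_def q.inputs_map flip: map_map)
    finally show ?thesis
      using that by (auto simp: composable_def q.nodes_map)
  qed
  show ?thesis
    by unfold_locales
      (simp_all add: q.colors_map r.colors_map q.nodes_map r.nodes_map q.inputs_map r.inputs_map
        q.output_map r.output_map q.oid_map r.oid_map q.ocomp_map r.ocomp_map comp)
qed

theorem free_operad_universal:
  fixes S :: "('c, 'v) species" and D :: "('d, 'p) operad"
  assumes "free_operad S D etaC etaV"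
  shows "universal_at TYPE(('e, 'g) operad) S D etaC etaV"
proof -
  let ?T = "tree_operad S"
  have D: "operad D" and eta: "species_map S D etaC etaV"
    and u1: "universal_at TYPE(('d, 'p) operad) S D etaC etaV"
    and u2: "universal_at TYPE(('c, ('c, 'v) tree) operad) S D etaC etaV"
    using assms by (auto simp: free_operad_def universal_at_def)
  interpret eta: species_map S D etaC etaV by fact
  have S: "species S" by unfold_locales
  have T: "operad ?T" "species_map S ?T id (corolla S)"
    using operad_tree_operad[OF S] species_map_corolla[OF S] .
  interpret cor: species_map S ?T id "corolla S" by fact
  obtain rC rV where r: "operad_functor D ?T rC rV"
    "extends_along S etaC etaV rC rV id (corolla S)"
    using u2 T unfolding universal_at_def by blast
  define t where "t = eval_tree D etaC etaV"
  have t: "operad_functor ?T D etaC t" "extends_along S id (corolla S) etaC t etaC etaV"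
    using operad_functor_eval_tree[OF D eta] by (auto simp: t_def)
  have tr: "operad_functor D D (etaC \<circ> rC) (t \<circ> rV)"
    using operad_functor_comp[OF r(1) t(1)] .
  have tr_ext: "extends_along S etaC etaV (etaC \<circ> rC) (t \<circ> rV) etaC etaV"
    using r(2) t(2) by (auto simp: extends_along_def)
  have id_ext: "extends_along S etaC etaV id id etaC etaV"
    by (simp add: extends_along_def)
  have tr_id: "\<forall>A\<in>colors D. etaC (rC A) = A" "\<forall>f\<in>nodes D. t (rV f) = f"
    using u1 D eta tr tr_ext operad_functor_id[OF D] id_ext unfolding universal_at_def
    by (metis comp_apply id_apply)+
  show ?thesis
    unfolding universal_at_def
  proof (intro conjI allI impI D eta)
    fix E :: "('e, 'g) operad" and phiC phiV
    assume *: "operad E \<and> species_map S E phiC phiV"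
    define q where "q = eval_tree E phiC phiV"
    have q: "operad_functor ?T E phiC q" "extends_along S id (corolla S) phiC q phiC phiV"
      using operad_functor_eval_tree * by (auto simp: q_def)
    have 1: "operad_functor D E (phiC \<circ> rC) (q \<circ> rV)"
      using operad_functor_comp[OF r(1) q(1)] .
    have 2: "extends_along S etaC etaV (phiC \<circ> rC) (q \<circ> rV) phiC phiV"
      using r(2) q(2) by (auto simp: extends_along_def)
    have 3: "(\<forall>A\<in>colors D. sC A = (phiC \<circ> rC) A) \<and> (\<forall>f\<in>nodes D. sV f = (q \<circ> rV) f)"
      if s: "operad_functor D E sC sV \<and> extends_along S etaC etaV sC sV phiC phiV" for sC sV
    proof -
      interpret r: operad_functor D ?T rC rV by fact
      have st: "operad_functor ?T E (sC \<circ> etaC) (sV \<circ> t)"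
        using operad_functor_comp[OF t(1)] s by blast
      have st_ext: "extends_along S id (corolla S) (sC \<circ> etaC) (sV \<circ> t) phiC phiV"
        using s t(2) by (auto simp: extends_along_def)
      have "sV (t u) = q u" if "u \<in> nodes ?T" for u
        using tree_functor_unique[OF S st st_ext, of u] that by (simp add: q_def tree_operad_def)
      moreover have "sC (etaC R) = phiC R" if "R \<in> colors ?T" for R
        using s that by (simp add: extends_along_def tree_operad_def)
      ultimately show ?thesis
        using tr_id r.nodes_map r.colors_map by (metis comp_apply)
    qed
    show "\<exists>qC qV. operad_functor D E qC qV \<and> extends_along S etaC etaV qC qV phiC phiV \<and>
        (\<forall>rC rV. operad_functor D E rC rV \<and> extends_along S etaC etaV rC rV phiC phiV \<longrightarrow>
           (\<forall>A\<in>colors D. rC A = qC A) \<and> (\<forall>f\<in>nodes D. rV f = qV f))"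
      using 1 2 3 by blast
  qed
qed


section \<open>Families of multi-legged spans and fibers\<close>

text \<open>
  A family of spans indexed by operations.  The value of \<open>inlegs X f\<close> at an element of
  \<open>apex X f\<close> lists the values of the \<open>n\<close> input legs.
\<close>

record ('f, 'x, 'c) span_family =
  apex :: "'f \<Rightarrow> 'x set"
  inlegs :: "'f \<Rightarrow> 'x \<Rightarrow> 'c list"
  outleg :: "'f \<Rightarrow> 'x \<Rightarrow> 'c"

definition spans_over ::
  "('a, 'f) operad \<Rightarrow> ('a \<Rightarrow> 'c set) \<Rightarrow> ('f, 'x, 'c, 'z) span_family_scheme \<Rightarrow> bool" where
  "spans_over P F X \<longleftrightarrow>
     (\<forall>f\<in>nodes P. \<forall>a\<in>apex X f.
        list_all2 (\<lambda>R A. R \<in> F A) (inlegs X f a) (incolors P f) \<and> outleg X f a \<in> F (outcolor P f))"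

text \<open>
  The composite of the spans \<open>X g\<close> and \<open>X h\<close> for \<open>h\<close> in \<open>hs\<close>, as a set of pairs.
\<close>

definition span_comp ::
  "('f, 'x, 'c, 'z) span_family_scheme \<Rightarrow> 'f \<Rightarrow> 'f list \<Rightarrow> ('x \<times> 'x list) set" where
  "span_comp X g hs =
     {(a, as). a \<in> apex X g \<and> list_all2 (\<lambda>h b. b \<in> apex X h) hs as \<and>
        map2 (outleg X) hs as = inlegs X g a}"

record ('f, 'x, 'c, 'a) lax_span_functor = "('f, 'x, 'c) span_family" +
  on_color :: "'a \<Rightarrow> 'c set"
  lax_id :: "'a \<Rightarrow> 'c \<Rightarrow> 'x"
  lax_comp :: "'f \<Rightarrow> 'f list \<Rightarrow> 'x \<times> 'x list \<Rightarrow> 'x"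

locale lax_span_functor = operad P
  for P :: "('a, 'f) operad" and F :: "('f, 'x, 'c, 'a) lax_span_functor" +
  assumes spans: "spans_over P (on_color F) F"
    and lax_id:
      "\<lbrakk>A \<in> colors P; R \<in> on_color F A\<rbrakk> \<Longrightarrow>
         lax_id F A R \<in> apex F (oid P A) \<and>
         inlegs F (oid P A) (lax_id F A R) = [R] \<and> outleg F (oid P A) (lax_id F A R) = R"
    and lax_comp:
      "\<lbrakk>composable P g hs; (a, as) \<in> span_comp F g hs\<rbrakk> \<Longrightarrow>
         lax_comp F g hs (a, as) \<in> apex F (ocomp P g hs) \<and>
         inlegs F (ocomp P g hs) (lax_comp F g hs (a, as)) = concat (map2 (inlegs F) hs as) \<and>
         outleg F (ocomp P g hs) (lax_comp F g hs (a, as)) = outleg F g a"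
    and lax_unit_left:
      "\<lbrakk>g \<in> nodes P; a \<in> apex F g\<rbrakk> \<Longrightarrow>
         lax_comp F (oid P (outcolor P g)) [g] (lax_id F (outcolor P g) (outleg F g a), [a]) = a"
    and lax_unit_right:
      "\<lbrakk>g \<in> nodes P; a \<in> apex F g\<rbrakk> \<Longrightarrow>
         lax_comp F g (map (oid P) (incolors P g)) (a, map2 (lax_id F) (incolors P g) (inlegs F g a)) = a"
    and lax_assoc:
      "\<lbrakk>composable P f gs; list_all2 (composable P) gs hss;
        (a, as) \<in> span_comp F f gs;
        list_all2 (\<lambda>(g, hs) (b, bs). (b, bs) \<in> span_comp F g hs) (zip gs hss) (zip as bss);
        length as = length bss\<rbrakk> \<Longrightarrow>
         lax_comp F (ocomp P f gs) (concat hss) (lax_comp F f gs (a, as), concat bss) =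
         lax_comp F f (map2 (ocomp P) gs hss)
           (a, map2 (\<lambda>(g, hs) (b, bs). lax_comp F g hs (b, bs)) (zip gs hss) (zip as bss))"

definition fiber ::
  "('d, 'p) operad \<Rightarrow> ('d \<Rightarrow> 'a) \<Rightarrow> ('p \<Rightarrow> 'f) \<Rightarrow> ('f, 'p, 'd, 'a) lax_span_functor" where
  "fiber D pC pV =
     \<lparr>apex = (\<lambda>f. {a \<in> nodes D. pV a = f}), inlegs = (\<lambda>f. incolors D), outleg = (\<lambda>f. outcolor D),
      on_color = (\<lambda>A. {R \<in> colors D. pC R = A}),
      lax_id = (\<lambda>A. oid D), lax_comp = (\<lambda>g hs (a, as). ocomp D a as)\<rparr>"

lemma fiber_span_comp:
  assumes "operad_functor D P pC pV" "(a, as) \<in> span_comp (fiber D pC pV) g hs"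
  shows "composable D a as" "pV a = g" "map pV as = hs"
proof -
  have *: "a \<in> nodes D" "pV a = g" "list_all2 (\<lambda>h b. b \<in> nodes D \<and> pV b = h) hs as"
    "map2 (\<lambda>f. outcolor D) hs as = incolors D a"
    using assms(2) by (auto simp: span_comp_def fiber_def)
  have "map2 (\<lambda>f. outcolor D) hs as = map (outcolor D) as"
    using *(3) by (induction rule: list_all2_induct) auto
  moreover have "set as \<subseteq> nodes D" "map pV as = hs"
    using *(3) by (induction rule: list_all2_induct) auto
  ultimately show "composable D a as" "pV a = g" "map pV as = hs"
    using * by (auto simp: composable_def)
qed

lemma lax_span_functor_fiber:
  assumes "operad_functor D P pC pV"
  shows "lax_span_functor P (fiber D pC pV)"
proof -
  interpret operad_functor D P pC pV by fact
  note sc = fiber_span_comp[OF assms]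
  show ?thesis
  proof
    show "spans_over P (on_color (fiber D pC pV)) (fiber D pC pV)"
      using D.inputs_closed D.output_closed
      by (auto simp: spans_over_def fiber_def inputs_map output_map list_all2_map2 subset_iff
          intro!: list.rel_refl_strong)
  next
    fix g hs a as
    assume c: "(a, as) \<in> span_comp (fiber D pC pV) g hs"
    have "map2 (\<lambda>f. incolors D) hs as = map (incolors D) as"
      using sc(3)[OF c] by (auto intro!: nth_equalityI)
    then show "lax_comp (fiber D pC pV) g hs (a, as) \<in> apex (fiber D pC pV) (ocomp P g hs) \<and>
      inlegs (fiber D pC pV) (ocomp P g hs) (lax_comp (fiber D pC pV) g hs (a, as)) =
        concat (map2 (inlegs (fiber D pC pV)) hs as) \<and>
      outleg (fiber D pC pV) (ocomp P g hs) (lax_comp (fiber D pC pV) g hs (a, as)) =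
        outleg (fiber D pC pV) g a"
      using sc[OF c] ocomp_map[OF sc(1)[OF c]]
      by (simp add: fiber_def D.ocomp_closed D.inputs_ocomp D.output_ocomp)
  next
    fix g a assume "g \<in> nodes P" "a \<in> apex (fiber D pC pV) g"
    then have a: "a \<in> nodes D" "pV a = g" by (auto simp: fiber_def)
    have "map2 (\<lambda>A. oid D) (incolors P g) (incolors D a) = map (oid D) (incolors D a)"
      using a by (auto intro!: nth_equalityI simp: inputs_map simp flip: a(2))
    then show "lax_comp (fiber D pC pV) g (map (oid P) (incolors P g))
        (a, map2 (lax_id (fiber D pC pV)) (incolors P g) (inlegs (fiber D pC pV) g a)) = a"
      using a by (simp add: fiber_def D.ocomp_oid_right)
  next
    fix f gs hss a as bss
    assume c: "(a, as) \<in> span_comp (fiber D pC pV) f gs" and len: "length as = length bss"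
      and l: "list_all2 (\<lambda>(g, hs) (b, bs). (b, bs) \<in> span_comp (fiber D pC pV) g hs)
        (zip gs hss) (zip as bss)" and l2: "list_all2 (composable P) gs hss"
    have len2: "length gs = length as" "length gs = length hss"
      using arg_cong[OF sc(3)[OF c], of length] list_all2_lengthD[OF l2] by simp_all
    have "list_all2 (composable D) as bss"
      using l len len2 sc(1) by (fastforce simp: list_all2_conv_all_nth)
    note assoc = D.ocomp_assoc[OF sc(1)[OF c] this]
    have "map2 (\<lambda>(g, hs) (b, bs). ocomp D b bs) (zip gs hss) (zip as bss) = map2 (ocomp D) as bss"
      using len len2 by (auto intro!: nth_equalityI)
    with assoc show "lax_comp (fiber D pC pV) (ocomp P f gs) (concat hss)
        (lax_comp (fiber D pC pV) f gs (a, as), concat bss) =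
      lax_comp (fiber D pC pV) f (map2 (ocomp P) gs hss)
        (a, map2 (\<lambda>(g, hs) (b, bs). lax_comp (fiber D pC pV) g hs (b, bs)) (zip gs hss) (zip as bss))"
      by (simp add: fiber_def)
  qed (auto simp: fiber_def D.oid_closed D.inputs_oid D.output_oid oid_map D.ocomp_oid_left)
qed

definition span_map ::
  "('a, 'f) operad \<Rightarrow> ('f, 'x, 'c) span_family \<Rightarrow> ('f, 'y, 'c) span_family \<Rightarrow>
   ('f \<Rightarrow> 'x \<Rightarrow> 'y) \<Rightarrow> bool" where
  "span_map P X Y m \<longleftrightarrow>
     (\<forall>f\<in>nodes P. \<forall>a\<in>apex X f.
        m f a \<in> apex Y f \<and> inlegs Y f (m f a) = inlegs X f a \<and> outleg Y f (m f a) = outleg X f a)"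

definition span_iso ::
  "('a, 'f) operad \<Rightarrow> ('f, 'x, 'c) span_family \<Rightarrow> ('f, 'y, 'c) span_family \<Rightarrow>
   ('f \<Rightarrow> 'x \<Rightarrow> 'y) \<Rightarrow> bool" where
  "span_iso P X Y m \<longleftrightarrow>
     span_map P X Y m \<and> (\<forall>f\<in>nodes P. bij_betw (m f) (apex X f) (apex Y f))"

definition relabel :: "('d \<Rightarrow> 'c) \<Rightarrow> ('f, 'x, 'd, 'z) span_family_scheme \<Rightarrow> ('f, 'x, 'c) span_family"
  where
  "relabel j X =
     \<lparr>apex = apex X, inlegs = (\<lambda>f a. map j (inlegs X f a)), outleg = (\<lambda>f a. j (outleg X f a))\<rparr>"


section \<open>The endofunctor of the recursive formula\<close>

definition color_fiber :: "('c, 'v) species \<Rightarrow> ('c \<Rightarrow> 'a) \<Rightarrow> 'a \<Rightarrow> 'c set" where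
  "color_fiber S phiC A = {R \<in> colors S. phiC R = A}"

text \<open>
  \<open>Comp g hs x as\<close> is the formal composite of \<open>x\<close> with \<open>as\<close> in the summand indexed by the
  decomposition \<open>g \<circ> hs\<close>.
\<close>

datatype ('c, 'v, 'f, 'x) formal = Ident 'c | Comp 'f "'f list" 'v "'x list"

definition id_summand ::
  "('c, 'v) species \<Rightarrow> ('a, 'f) operad \<Rightarrow> ('c \<Rightarrow> 'a) \<Rightarrow> 'f \<Rightarrow> ('c, 'v, 'f, 'x) formal set" where
  "id_summand S P phiC f =
     {Ident R | R A. A \<in> colors P \<and> f = oid P A \<and> R \<in> color_fiber S phiC A}"

definition bullet ::
  "('c, 'v) species \<Rightarrow> ('v \<Rightarrow> 'f) \<Rightarrow> ('f, 'x, 'c) span_family \<Rightarrow> 'f \<Rightarrow> 'f list \<Rightarrow>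
   ('c, 'v, 'f, 'x) formal set" where
  "bullet S phiV X g hs =
     {Comp g hs x as | x as. x \<in> nodes S \<and> phiV x = g \<and>
        list_all2 (\<lambda>h a. a \<in> apex X h) hs as \<and> map2 (outleg X) hs as = incolors S x}"

definition comp_summand ::
  "('c, 'v) species \<Rightarrow> ('a, 'f) operad \<Rightarrow> ('v \<Rightarrow> 'f) \<Rightarrow> ('f, 'x, 'c) span_family \<Rightarrow> 'f \<Rightarrow>
   ('c, 'v, 'f, 'x) formal set" where
  "comp_summand S P phiV X f =
     (\<Union>(g, hs) \<in> {(g, hs). composable P g hs \<and> f = ocomp P g hs}. bullet S phiV X g hs)"

fun formal_inlegs :: "('f, 'x, 'c) span_family \<Rightarrow> ('c, 'v, 'f, 'x) formal \<Rightarrow> 'c list" where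
  "formal_inlegs X (Ident R) = [R]"
| "formal_inlegs X (Comp g hs x as) = concat (map2 (inlegs X) hs as)"

fun formal_outleg :: "('c, 'v) species \<Rightarrow> ('c, 'v, 'f, 'x) formal \<Rightarrow> 'c" where
  "formal_outleg S (Ident R) = R"
| "formal_outleg S (Comp g hs x as) = outcolor S x"

definition rhs ::
  "('c, 'v) species \<Rightarrow> ('a, 'f) operad \<Rightarrow> ('c \<Rightarrow> 'a) \<Rightarrow> ('v \<Rightarrow> 'f) \<Rightarrow>
   ('f, 'x, 'c) span_family \<Rightarrow> ('f, ('c, 'v, 'f, 'x) formal, 'c) span_family" where
  "rhs S P phiC phiV X =
     \<lparr>apex = (\<lambda>f. id_summand S P phiC f \<union> comp_summand S P phiV X f),
      inlegs = (\<lambda>f. formal_inlegs X), outleg = (\<lambda>f. formal_outleg S)\<rparr>"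

fun rhs_map :: "('f \<Rightarrow> 'x \<Rightarrow> 'y) \<Rightarrow> 'f \<Rightarrow> ('c, 'v, 'f, 'x) formal \<Rightarrow> ('c, 'v, 'f, 'y) formal" where
  "rhs_map m f (Ident R) = Ident R"
| "rhs_map m f (Comp g hs x as) = Comp g hs x (map2 m hs as)"

definition rhs_algebra ::
  "('c, 'v) species \<Rightarrow> ('a, 'f) operad \<Rightarrow> ('c \<Rightarrow> 'a) \<Rightarrow> ('v \<Rightarrow> 'f) \<Rightarrow>
   ('f, 'x, 'c) span_family \<Rightarrow> ('f \<Rightarrow> ('c, 'v, 'f, 'x) formal \<Rightarrow> 'x) \<Rightarrow> bool" where
  "rhs_algebra S P phiC phiV X s \<longleftrightarrow>
     spans_over P (color_fiber S phiC) X \<and> span_map P (rhs S P phiC phiV X) X s"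

definition algebra_map ::
  "('c, 'v) species \<Rightarrow> ('a, 'f) operad \<Rightarrow> ('c \<Rightarrow> 'a) \<Rightarrow> ('v \<Rightarrow> 'f) \<Rightarrow>
   ('f, 'x, 'c) span_family \<Rightarrow> ('f \<Rightarrow> ('c, 'v, 'f, 'x) formal \<Rightarrow> 'x) \<Rightarrow>
   ('f, 'y, 'c) span_family \<Rightarrow> ('f \<Rightarrow> ('c, 'v, 'f, 'y) formal \<Rightarrow> 'y) \<Rightarrow> ('f \<Rightarrow> 'x \<Rightarrow> 'y) \<Rightarrow> bool" where
  "algebra_map S P phiC phiV X s Y t m \<longleftrightarrow>
     span_map P X Y m \<and>
     (\<forall>f\<in>nodes P. \<forall>u\<in>apex (rhs S P phiC phiV X) f. m f (s f u) = t f (rhs_map m f u))"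

text \<open>
  Initiality among the algebras with elements in \<open>'y\<close>.  A theorem with conclusion
  \<open>initial_algebra TYPE('y)\<close> for a type variable \<open>'y\<close> asserts it for algebras over all types.
\<close>

definition initial_algebra ::
  "'y itself \<Rightarrow> ('c, 'v) species \<Rightarrow> ('a, 'f) operad \<Rightarrow> ('c \<Rightarrow> 'a) \<Rightarrow> ('v \<Rightarrow> 'f) \<Rightarrow>
   ('f, 'x, 'c) span_family \<Rightarrow> ('f \<Rightarrow> ('c, 'v, 'f, 'x) formal \<Rightarrow> 'x) \<Rightarrow> bool" where
  "initial_algebra ty S P phiC phiV X s \<longleftrightarrow>
     rhs_algebra S P phiC phiV X s \<and>
     (\<forall>(Y :: ('f, 'y, 'c) span_family) t. rhs_algebra S P phiC phiV Y t \<longrightarrow>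
        (\<exists>m. algebra_map S P phiC phiV X s Y t m \<and>
           (\<forall>n. algebra_map S P phiC phiV X s Y t n \<longrightarrow>
              (\<forall>f\<in>nodes P. \<forall>a\<in>apex X f. n f a = m f a))))"

text \<open>
  The interpretation of formal identities and composites in a lax functor, along a map of species
  \<open>(etaC, etaV)\<close>: \<open>R\<close> is sent to the identity on \<open>etaC R\<close>, and the formal composite of \<open>x\<close> with
  \<open>as\<close> to the composite of \<open>etaV x\<close> with \<open>as\<close>.
\<close>

fun interpret_formal ::
  "('c \<Rightarrow> 'a) \<Rightarrow> ('c \<Rightarrow> 'd) \<Rightarrow> ('v \<Rightarrow> 'p) \<Rightarrow> ('f, 'p, 'd, 'a) lax_span_functor \<Rightarrow>
   'f \<Rightarrow> ('c, 'v, 'f, 'p) formal \<Rightarrow> 'p" where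
  "interpret_formal phiC etaC etaV F f (Ident R) = lax_id F (phiC R) (etaC R)"
| "interpret_formal phiC etaC etaV F f (Comp g hs x as) = lax_comp F g hs (etaV x, as)"

definition constant_op :: "('a, 'f) operad \<Rightarrow> 'f \<Rightarrow> bool" where
  "constant_op P c \<longleftrightarrow> c \<in> nodes P \<and> incolors P c = []"

definition constant_summand ::
  "('c, 'v) species \<Rightarrow> ('a, 'f) operad \<Rightarrow> ('v \<Rightarrow> 'f) \<Rightarrow> ('f, 'x, 'c) span_family \<Rightarrow> 'f \<Rightarrow>
   ('c, 'v, 'f, 'x) formal set" where
  "constant_summand S P phiV X c =
     (\<Union>(g, cs) \<in> {(g, cs). composable P g cs \<and> list_all (constant_op P) cs \<and> c = ocomp P g cs}.
        bullet S phiV X g cs)"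

end

theory Submission
  imports Defs
begin

text \<open>
  Up to isomorphism the free operad consists of trees, and a tree lies over the operation to which
  it evaluates in \<open>P\<close>.  Splitting a tree at its root identifies the trees over \<open>f\<close> with the formal
  identities and composites over \<open>f\<close> of trees, and recursion on trees gives initiality.
\<close>

section \<open>Span families whose elements correspond to trees\<close>

lemma eval_tree_composable:
  fixes S :: "('c, 'v) species" and E :: "('e, 'g) operad"
  assumes "operad E" "species_map S E phiC phiV" "wf_tree S (Node x ts)"
  shows "composable E (phiV x) (map (eval_tree E phiC phiV) ts)"
proof -
  interpret species_map S E phiC phiV by fact
  have x: "x \<in> nodes S" "map (root S) ts = incolors S x" and ts: "\<forall>t\<in>set ts. wf_tree S t"
    using assms(3) by (auto simp: list_all_iff)
  have "map (outcolor E) (map (eval_tree E phiC phiV) ts) = map phiC (map (root S) ts)"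
    using ts eval_tree_typed[OF assms(1,2)] by simp
  then have "map (outcolor E) (map (eval_tree E phiC phiV) ts) = incolors E (phiV x)"
    using x by (simp only: inputs_map)
  then show ?thesis
    using x ts eval_tree_typed[OF assms(1,2)] by (auto simp: composable_def nodes_map)
qed

text \<open>The interface between the free operad and the recursive formula: \<open>tau\<close>
  names the elements over each operation by the trees evaluating to it, leaves and root give the
  legs, and \<open>s\<close> attaches subtrees to a node. The axioms fix \<open>s\<close> only on
  formal expressions built from values of \<open>tau\<close>; since \<open>tau\<close> is surjective
  over each operation, these exhaust the right-hand side.\<close>

locale tree_family =
  P: operad P + species_map S P phiC phiV
  for S :: "('c, 'v) species" and P :: "('a, 'f) operad" and phiC phiV +
  fixes X :: "('f, 'x, 'c) span_family" and s :: "'f \<Rightarrow> ('c, 'v, 'f, 'x) formal \<Rightarrow> 'x"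
    and tau :: "('c, 'v) tree \<Rightarrow> 'x"
  assumes bij_tau: "f \<in> nodes P \<Longrightarrow>
      bij_betw tau {t. wf_tree S t \<and> eval_tree P phiC phiV t = f} (apex X f)"
    and inlegs_tau: "wf_tree S t \<Longrightarrow> inlegs X (eval_tree P phiC phiV t) (tau t) = leaves t"
    and outleg_tau: "wf_tree S t \<Longrightarrow> outleg X (eval_tree P phiC phiV t) (tau t) = root S t"
    and s_Ident: "R \<in> colors S \<Longrightarrow> s (oid P (phiC R)) (Ident R) = tau (Leaf R)"
    and s_Comp: "wf_tree S (Node x ts) \<Longrightarrow>
      s (eval_tree P phiC phiV (Node x ts))
        (Comp (phiV x) (map (eval_tree P phiC phiV) ts) x (map tau ts)) = tau (Node x ts)"
begin

abbreviation ev :: "('c, 'v) tree \<Rightarrow> 'f" where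
  "ev \<equiv> eval_tree P phiC phiV"

abbreviation trees :: "'f \<Rightarrow> ('c, 'v) tree set" where
  "trees f \<equiv> {t. wf_tree S t \<and> ev t = f}"

lemma ev_typed:
  assumes "wf_tree S t"
  shows "ev t \<in> nodes P" "incolors P (ev t) = map phiC (leaves t)"
    "outcolor P (ev t) = phiC (root S t)"
  using eval_tree_typed[OF P.operad_axioms species_map_axioms assms] by auto

lemma ev_composable: "wf_tree S (Node x ts) \<Longrightarrow> composable P (phiV x) (map ev ts)"
  by (rule eval_tree_composable[OF P.operad_axioms species_map_axioms])

lemma tau_mem: "wf_tree S t \<Longrightarrow> tau t \<in> apex X (ev t)"
  using bij_betwE[OF bij_tau[OF ev_typed(1)]] by blast

section \<open>Splitting a tree at its root\<close>

definition typed_at :: "('f, 'y, 'c) span_family \<Rightarrow> ('c, 'v) tree \<Rightarrow> 'y \<Rightarrow> bool" where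
  "typed_at Y t y \<longleftrightarrow>
     y \<in> apex Y (ev t) \<and> inlegs Y (ev t) y = leaves t \<and> outleg Y (ev t) y = root S t"

lemma typed_at_tau: "wf_tree S t \<Longrightarrow> typed_at X t (tau t)"
  by (simp add: typed_at_def tau_mem inlegs_tau outleg_tau)

text \<open>The decomposition recorded in \<open>Comp\<close> is forced by the tree. The labelling
  \<open>k\<close> of subtrees is left open because it is \<open>tau\<close> for the isomorphism and
  a fold for initiality.\<close>

fun split_root :: "(('c, 'v) tree \<Rightarrow> 'y) \<Rightarrow> ('c, 'v) tree \<Rightarrow> ('c, 'v, 'f, 'y) formal" where
  "split_root k (Leaf R) = Ident R"
| "split_root k (Node x ts) = Comp (phiV x) (map ev ts) x (map k ts)"

lemma s_split_root: "wf_tree S t \<Longrightarrow> s (ev t) (split_root tau t) = tau t"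
  by (cases t) (use s_Ident s_Comp in auto)

text \<open>Color matching in \<open>bullet\<close> is the root condition of \<open>wf_tree\<close>,
  and concatenating the input legs gives the leaves. The hypothesis concerns immediate subtrees
  only, so that the lemma can serve as an induction step.\<close>

lemma typed_at_split_root:
  assumes "wf_tree S t" "\<And>x ts u. t = Node x ts \<Longrightarrow> u \<in> set ts \<Longrightarrow> typed_at Y u (k u)"
  shows "typed_at (rhs S P phiC phiV Y) t (split_root k t)"
proof (cases t)
  case (Leaf R)
  then show ?thesis using assms(1) colors_map
    by (auto simp: typed_at_def rhs_def id_summand_def color_fiber_def)
next
  case (Node x ts)
  have k: "k u \<in> apex Y (ev u)" "inlegs Y (ev u) (k u) = leaves u"
    "outleg Y (ev u) (k u) = root S u" if "u \<in> set ts" for u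
    using assms(2)[OF Node that] by (auto simp: typed_at_def)
  have wf: "wf_tree S (Node x ts)" using assms(1) Node by simp
  have legs: "map2 (inlegs Y) (map ev ts) (map k ts) = map leaves ts"
    "map2 (outleg Y) (map ev ts) (map k ts) = map (root S) ts"
    using k by (auto intro!: nth_equalityI)
  have mem: "list_all2 (\<lambda>h a. a \<in> apex Y h) (map ev ts) (map k ts)"
    using k by (auto simp: list_all2_conv_all_nth)
  have "split_root k t \<in> bullet S phiV Y (phiV x) (map ev ts)"
    unfolding bullet_def Node split_root.simps using wf legs(2) mem by (intro CollectI exI conjI refl) auto
  then have "split_root k t \<in> comp_summand S P phiV Y (ev t)"
    unfolding comp_summand_def using ev_composable[OF wf] Node by auto
  then show ?thesis
    unfolding typed_at_def rhs_def using Node legs(1) by simp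
qed

lemma obtain_trees:
  assumes "set hs \<subseteq> nodes P" "list_all2 (\<lambda>h a. a \<in> apex X h) hs as"
  obtains ts where "hs = map ev ts" "as = map tau ts" "list_all (wf_tree S) ts"
proof -
  from assms(2,1) have "\<exists>ts. hs = map ev ts \<and> as = map tau ts \<and> list_all (wf_tree S) ts"
  proof (induction rule: list_all2_induct)
    case (Cons h hs a as)
    then obtain ts where ts: "hs = map ev ts" "as = map tau ts" "list_all (wf_tree S) ts" by auto
    from Cons have "a \<in> tau ` trees h" using bij_betw_imp_surj_on[OF bij_tau] by auto
    then obtain t where "wf_tree S t" "ev t = h" "a = tau t" by auto
    with ts show ?case by (intro exI[of _ "t # ts"]) simp
  qed simp
  then show ?thesis using that by blast
qed

text \<open>Leaves account for the formal identities. In a formal composite of \<open>x\<close> with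
  \<open>as\<close>, each entry of \<open>as\<close> comes from a tree by surjectivity of
  \<open>tau\<close>, and color matching says exactly that these trees can be attached to
  \<open>x\<close>.\<close>

lemma apex_rhs: "apex (rhs S P phiC phiV X) f = split_root tau ` trees f"
proof (intro equalityI subsetI)
  fix u assume "u \<in> split_root tau ` trees f"
  then obtain t where t: "wf_tree S t" "ev t = f" "u = split_root tau t" by auto
  have "typed_at X v (tau v)" if "t = Node x ts" "v \<in> set ts" for x ts v
    using t(1) that by (auto simp: list_all_iff intro: typed_at_tau)
  from typed_at_split_root[of t X tau, OF t(1) this] t show "u \<in> apex (rhs S P phiC phiV X) f"
    by (simp add: typed_at_def)
next
  fix u assume "u \<in> apex (rhs S P phiC phiV X) f"
  then consider "u \<in> id_summand S P phiC f" | "u \<in> comp_summand S P phiV X f"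
    by (auto simp: rhs_def)
  then show "u \<in> split_root tau ` trees f"
  proof cases
    case 1
    then obtain R where R: "u = Ident R" "R \<in> colors S" "f = oid P (phiC R)"
      by (auto simp: id_summand_def color_fiber_def)
    then show ?thesis by (intro image_eqI[of _ _ "Leaf R"]) auto
  next
    case 2
    then obtain g hs x as where c: "composable P g hs" "f = ocomp P g hs" "u = Comp g hs x as"
      "x \<in> nodes S" "phiV x = g" "list_all2 (\<lambda>h a. a \<in> apex X h) hs as"
      "map2 (outleg X) hs as = incolors S x"
      by (auto simp: comp_summand_def bullet_def)
    obtain ts where ts: "hs = map ev ts" "as = map tau ts" "list_all (wf_tree S) ts"
      using obtain_trees c(1,6) by (auto simp: composable_def)
    have "map2 (outleg X) (map ev ts) (map tau ts) = map (root S) ts"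
      using ts(3) by (auto intro!: nth_equalityI simp: outleg_tau list_all_length)
    then have "wf_tree S (Node x ts)" using c(4,7) ts by simp
    then show ?thesis using c ts by (intro image_eqI[of _ _ "Node x ts"]) auto
  qed
qed

lemma typed_at_split_root_tau:
  assumes "wf_tree S t"
  shows "typed_at (rhs S P phiC phiV X) t (split_root tau t)"
  using assms by (intro typed_at_split_root) (auto simp: list_all_iff intro: typed_at_tau)

text \<open>By \<open>apex_rhs\<close>, \<open>split_root tau\<close> maps the trees over
  \<open>f\<close> onto the right-hand side, and following it by \<open>s f\<close> gives the
  bijection \<open>tau\<close>. Hence \<open>s f\<close> is injective on that image and onto
  \<open>apex X f\<close>.\<close>

lemma span_iso_s: "span_iso P (rhs S P phiC phiV X) X s"
  unfolding span_iso_def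
proof (intro conjI ballI)
  show "span_map P (rhs S P phiC phiV X) X s"
    unfolding span_map_def apex_rhs
    using typed_at_split_root_tau typed_at_tau by (auto simp: s_split_root typed_at_def)
  fix f assume f: "f \<in> nodes P"
  have eq: "(s f \<circ> split_root tau) t = tau t" if "t \<in> trees f" for t
    using that by (auto simp: s_split_root)
  have "bij_betw (s f \<circ> split_root tau) (trees f) (apex X f)"
    using bij_tau[OF f] eq by (subst bij_betw_cong[of _ _ tau]) auto
  then show "bij_betw (s f) (apex (rhs S P phiC phiV X) f) (apex X f)"
    unfolding apex_rhs bij_betw_def by (auto simp: image_comp intro: inj_on_imageI)
qed

lemma spans_over_X: "spans_over P (color_fiber S phiC) X"
  unfolding spans_over_def
proof (intro ballI)
  fix f a assume "f \<in> nodes P" "a \<in> apex X f"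
  then have "a \<in> tau ` trees f" using bij_betw_imp_surj_on[OF bij_tau] by auto
  then obtain t where t: "wf_tree S t" "f = ev t" "a = tau t" by auto
  have "set (leaves t) \<subseteq> colors S" "root S t \<in> colors S"
    using wf_tree_colors[OF S.species_axioms t(1)] by auto
  with t show "list_all2 (\<lambda>R A. R \<in> color_fiber S phiC A) (inlegs X f a) (incolors P f) \<and>
      outleg X f a \<in> color_fiber S phiC (outcolor P f)"
    by (auto simp: inlegs_tau outleg_tau ev_typed color_fiber_def list_all2_map2
        intro!: list.rel_refl_strong)
qed

lemma rhs_algebra_s: "rhs_algebra S P phiC phiV X s"
  using span_iso_s spans_over_X by (simp add: rhs_algebra_def span_iso_def)

section \<open>Recursion on trees and initiality\<close>

primrec fold_tree :: "('f \<Rightarrow> ('c, 'v, 'f, 'y) formal \<Rightarrow> 'y) \<Rightarrow> ('c, 'v) tree \<Rightarrow> 'y" where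
  "fold_tree t (Leaf R) = t (oid P (phiC R)) (Ident R)"
| "fold_tree t (Node x us) =
     t (ev (Node x us)) (Comp (phiV x) (map ev us) x (map (fold_tree t) us))"

lemma fold_tree_split_root: "fold_tree t u = t (ev u) (split_root (fold_tree t) u)"
  by (cases u) simp_all

text \<open>The legs are carried up the tree: splitting at the root respects them by
  \<open>typed_at_split_root\<close>, and the structure map \<open>t\<close> does so as a map of
  spans.\<close>

lemma typed_at_fold_tree:
  assumes "rhs_algebra S P phiC phiV Y t"
  shows "wf_tree S u \<Longrightarrow> typed_at Y u (fold_tree t u)"
proof (induction u)
  case (Leaf R)
  then have "typed_at (rhs S P phiC phiV Y) (Leaf R) (split_root (fold_tree t) (Leaf R))"
    by (intro typed_at_split_root) auto
  then show ?case
    using assms ev_typed(1)[OF Leaf] unfolding fold_tree_split_root[of t "Leaf R"]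
    by (auto simp: typed_at_def rhs_algebra_def span_map_def simp del: split_root.simps)
next
  case (Node x us)
  then have "typed_at (rhs S P phiC phiV Y) (Node x us) (split_root (fold_tree t) (Node x us))"
    by (intro typed_at_split_root) (auto simp: list_all_iff)
  then show ?case
    using assms ev_typed(1)[OF Node.prems] unfolding fold_tree_split_root[of t "Node x us"]
    by (auto simp: typed_at_def rhs_algebra_def span_map_def
        simp del: split_root.simps eval_tree.simps leaves.simps root.simps)
qed

lemma rhs_map_split_root:
  assumes "wf_tree S u" "\<And>x ts v. u = Node x ts \<Longrightarrow> v \<in> set ts \<Longrightarrow> m (ev v) (tau v) = k v"
  shows "rhs_map m f (split_root tau u) = split_root k u"
  using assms by (cases u) (auto intro!: nth_equalityI)

text \<open>Existence transports the fold along the inverse of \<open>tau\<close>. Uniqueness holds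
  because \<open>tau u\<close> is the value of \<open>s\<close> at the split of \<open>u\<close>, so
  the algebra equation determines a map at \<open>u\<close> from its values at the subtrees.\<close>

lemma initial_algebra_s: "initial_algebra TYPE('y) S P phiC phiV X s"
  unfolding initial_algebra_def
proof (intro conjI allI impI rhs_algebra_s)
  fix Y :: "('f, 'y, 'c) span_family" and t assume Y: "rhs_algebra S P phiC phiV Y t"
  \<comment> \<open>The inverse is taken over each \<open>f\<close> separately, since
    \<open>tau\<close> is assumed injective only on the trees over one operation.\<close>
  define m where "m f a = fold_tree t (inv_into (trees f) tau a)" for f a
  have m: "m (ev u) (tau u) = fold_tree t u" if "wf_tree S u" for u
    using that bij_betw_inv_into_left[OF bij_tau[OF ev_typed(1)[OF that]], of u]
    by (simp add: m_def)
  have ex_tree: "\<exists>u. wf_tree S u \<and> f = ev u \<and> a = tau u" if "f \<in> nodes P" "a \<in> apex X f" for f a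
    using that bij_betw_imp_surj_on[OF bij_tau[OF that(1)]] by auto
  have "span_map P X Y m"
    unfolding span_map_def
  proof (intro ballI)
    fix f a assume "f \<in> nodes P" "a \<in> apex X f"
    then obtain u where "wf_tree S u" "f = ev u" "a = tau u" using ex_tree by blast
    then show "m f a \<in> apex Y f \<and> inlegs Y f (m f a) = inlegs X f a \<and>
        outleg Y f (m f a) = outleg X f a"
      using typed_at_fold_tree[OF Y] m by (simp add: inlegs_tau outleg_tau typed_at_def)
  qed
  moreover have "m f (s f v) = t f (rhs_map m f v)"
    if v: "v \<in> apex (rhs S P phiC phiV X) f" for f v
  proof -
    from v obtain u where u: "wf_tree S u" "f = ev u" "v = split_root tau u"
      unfolding apex_rhs by blast
    have "rhs_map m f v = split_root (fold_tree t) u"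
      unfolding u(3) using u(1) m by (intro rhs_map_split_root) (auto simp: list_all_iff)
    then show ?thesis
      using u m fold_tree_split_root[of t u] by (simp add: s_split_root)
  qed
  moreover have "n f a = m f a"
    if n: "algebra_map S P phiC phiV X s Y t n" and f: "f \<in> nodes P" "a \<in> apex X f" for n f a
  proof -
    \<comment> \<open>Elements are replaced by the trees that name them, which makes induction
      available.\<close>
    have "wf_tree S u \<Longrightarrow> n (ev u) (tau u) = fold_tree t u" for u
    proof (induction u)
      case (Leaf R)
      then have "split_root tau (Leaf R) \<in> apex (rhs S P phiC phiV X) (ev (Leaf R))"
        unfolding apex_rhs by blast
      then show ?case
        using n ev_typed(1)[OF Leaf] s_split_root[OF Leaf]
        by (auto simp: algebra_map_def dest!: bspec[where x = "oid P (phiC R)"]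
            bspec[where x = "Ident R"])
    next
      case (Node x us)
      let ?u = "Node x us"
      have mem: "split_root tau ?u \<in> apex (rhs S P phiC phiV X) (ev ?u)"
        unfolding apex_rhs using Node.prems by blast
      have "n (ev ?u) (tau ?u) = n (ev ?u) (s (ev ?u) (split_root tau ?u))"
        using s_split_root[OF Node.prems] by simp
      also have "\<dots> = t (ev ?u) (rhs_map n (ev ?u) (split_root tau ?u))"
        using n ev_typed(1)[OF Node.prems] mem unfolding algebra_map_def by blast
      also have "rhs_map n (ev ?u) (split_root tau ?u) = split_root (fold_tree t) ?u"
        using Node by (intro rhs_map_split_root) (auto simp: list_all_iff)
      finally show ?case using fold_tree_split_root[of t ?u] by simp
    qed
    with ex_tree[OF f] m show ?thesis by auto
  qed
  ultimately show "\<exists>m. algebra_map S P phiC phiV X s Y t m \<and>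
      (\<forall>n. algebra_map S P phiC phiV X s Y t n \<longrightarrow> (\<forall>f\<in>nodes P. \<forall>a\<in>apex X f. n f a = m f a))"
    by (intro exI[of _ m]) (simp add: algebra_map_def[of S P phiC phiV X s Y t m])
qed

end

section \<open>Constant operations\<close>

context operad
begin

text \<open>An identity has exactly one input color, a constant has none.\<close>

lemma id_summand_constant:
  assumes "constant_op P c"
  shows "id_summand S P phiC c = {}"
  using assms inputs_oid by (fastforce simp: id_summand_def constant_op_def)

text \<open>The inputs of a composite are the concatenation of the inputs of \<open>hs\<close>,
  which is empty only if every member of \<open>hs\<close> is constant.\<close>

lemma comp_summand_constant:
  assumes "constant_op P c"
  shows "comp_summand S P phiV X c = constant_summand S P phiV X c"
proof -
  have "list_all (constant_op P) hs" if "composable P g hs" "c = ocomp P g hs" for g hs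
  proof -
    have "concat (map (incolors P) hs) = []"
      using inputs_ocomp[OF that(1)] assms that(2) by (simp add: constant_op_def)
    then show ?thesis
      using that(1) by (auto simp: constant_op_def list_all_iff composable_def)
  qed
  then show ?thesis unfolding comp_summand_def constant_summand_def by blast
qed

end

section \<open>The free operad as trees, and the fibers of its functor to \<open>P\<close>\<close>

lemma free_operad_bij:
  fixes S :: "('c, 'v) species" and D :: "('d, 'p) operad"
  assumes "free_operad S D etaC etaV"
  shows "bij_betw etaC (colors S) (colors D)"
    and "bij_betw (eval_tree D etaC etaV) {t. wf_tree S t} (nodes D)"
proof -
  let ?T = "tree_operad S" and ?t = "eval_tree D etaC etaV"
  have D: "operad D" and eta: "species_map S D etaC etaV"
    and u1: "universal_at TYPE(('d, 'p) operad) S D etaC etaV"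
    and u2: "universal_at TYPE(('c, ('c, 'v) tree) operad) S D etaC etaV"
    using assms by (auto simp: free_operad_def universal_at_def)
  interpret eta: species_map S D etaC etaV by fact
  have S: "species S" by unfold_locales
  have T: "operad ?T" "species_map S ?T id (corolla S)"
    using operad_tree_operad[OF S] species_map_corolla[OF S] .
  obtain rC rV where r: "operad_functor D ?T rC rV"
    "extends_along S etaC etaV rC rV id (corolla S)"
    using u2 T unfolding universal_at_def by blast
  interpret r: operad_functor D ?T rC rV by fact
  note t = operad_functor_eval_tree[OF D eta]
  have "extends_along S etaC etaV (etaC \<circ> rC) (?t \<circ> rV) etaC etaV"
    using r(2) t(2) by (auto simp: extends_along_def)
  moreover have "extends_along S etaC etaV id id etaC etaV"
    by (simp add: extends_along_def)
  \<comment> \<open>Passing to trees and back extends the unit along itself, as does the identity;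
    the universal property of \<open>D\<close> tested against \<open>D\<close> makes the two
    agree.\<close>
  ultimately have tr: "\<forall>A\<in>colors D. etaC (rC A) = A" "\<forall>f\<in>nodes D. ?t (rV f) = f"
    using u1 D eta operad_functor_comp[OF r(1) t(1)] operad_functor_id[OF D]
    unfolding universal_at_def by (metis comp_apply id_apply)+
  have ext: "extends_along S id (corolla S) (rC \<circ> etaC) (rV \<circ> ?t) id (corolla S)"
    "extends_along S id (corolla S) id id id (corolla S)"
    using r(2) t(2) by (auto simp: extends_along_def)
  \<comment> \<open>The opposite round trip and the identity both extend the corollas, so both are
    evaluation in the operad of trees.\<close>
  have rt: "rV (?t u) = u" if "wf_tree S u" for u
    using tree_functor_unique[OF S operad_functor_comp[OF t(1) r(1)] ext(1) that]
      tree_functor_unique[OF S operad_functor_id[OF T(1)] ext(2) that] by simp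
  show "bij_betw etaC (colors S) (colors D)"
    using r(2) tr eta.colors_map r.colors_map
    by (intro bij_betw_byWitness[of _ rC]) (auto simp: extends_along_def tree_operad_def)
  show "bij_betw ?t {t. wf_tree S t} (nodes D)"
    using rt tr eval_tree_typed[OF D eta] r.nodes_map
    by (intro bij_betw_byWitness[of _ rV]) (auto simp: tree_operad_def)
qed

lemma bij_betw_restrict:
  assumes "bij_betw h A B" "\<And>x. x \<in> A \<Longrightarrow> k (h x) = l x"
  shows "bij_betw h {x \<in> A. l x = c} {y \<in> B. k y = c}"
  using assms by (fastforce simp: bij_betw_def inj_on_def)

text \<open>Evaluation in \<open>D\<close> followed by \<open>pV\<close> is a functor on trees
  extending \<open>phiV\<close>, hence is evaluation in \<open>P\<close>. So the bijection between
  trees and operations of \<open>D\<close> restricts to fibers. Relabelling is needed because the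
  legs of \<open>fiber\<close> are colors of \<open>D\<close>, while the formula speaks of colors of
  \<open>S\<close>.\<close>

lemma tree_family_fiber:
  fixes S :: "('c, 'v) species" and P :: "('a, 'f) operad" and D :: "('d, 'p) operad"
  assumes P: "operad P" and phi: "species_map S P phiC phiV"
    and free: "free_operad S D etaC etaV"
    and p: "operad_functor D P pC pV"
    and ext: "extends_along S etaC etaV pC pV phiC phiV"
  shows "tree_family S P phiC phiV (relabel (inv_into (colors S) etaC) (fiber D pC pV))
    (interpret_formal phiC etaC etaV (fiber D pC pV)) (eval_tree D etaC etaV)"
proof -
  let ?t = "eval_tree D etaC etaV"
  have D: "operad D" and eta: "species_map S D etaC etaV"
    using free by (auto simp: free_operad_def universal_at_def)
  interpret P: operad P by fact
  interpret phi: species_map S P phiC phiV by fact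
  note t = operad_functor_eval_tree[OF D eta]
  note bij = free_operad_bij[OF free]
  have "extends_along S id (corolla S) (pC \<circ> etaC) (pV \<circ> ?t) phiC phiV"
    using ext t(2) by (auto simp: extends_along_def)
  from tree_functor_unique[OF phi.S.species_axioms operad_functor_comp[OF t(1) p] this]
  have pt: "pV (?t u) = eval_tree P phiC phiV u" if "wf_tree S u" for u
    using that by simp
  have j: "inv_into (colors S) etaC (etaC R) = R" if "R \<in> colors S" for R
    using bij(1) that by (rule bij_betw_inv_into_left)
  have col: "set (leaves u) \<subseteq> colors S" "root S u \<in> colors S" if "wf_tree S u" for u
    using wf_tree_colors[OF phi.S.species_axioms that] by auto
  show ?thesis
  proof unfold_locales
    fix f
    show "bij_betw ?t {t. wf_tree S t \<and> eval_tree P phiC phiV t = f}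
        (apex (relabel (inv_into (colors S) etaC) (fiber D pC pV)) f)"
      using bij_betw_restrict[OF bij(2), of pV "eval_tree P phiC phiV" f] pt
      by (simp add: relabel_def fiber_def)
  next
    fix u assume u: "wf_tree S u"
    show "inlegs (relabel (inv_into (colors S) etaC) (fiber D pC pV)) (eval_tree P phiC phiV u)
        (?t u) = leaves u"
      using eval_tree_typed[OF D eta u] col[OF u] j
      by (auto simp: relabel_def fiber_def intro!: map_idI)
    show "outleg (relabel (inv_into (colors S) etaC) (fiber D pC pV)) (eval_tree P phiC phiV u)
        (?t u) = root S u"
      using eval_tree_typed[OF D eta u] col[OF u] j by (simp add: relabel_def fiber_def)
  \<comment> \<open>The axioms on \<open>s\<close> remain: the lax structure of the fiber is
    identity and composition in \<open>D\<close>, so \<open>interpret_formal\<close> follows the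
    recursion of \<open>eval_tree\<close>.\<close>
  qed (simp_all add: fiber_def)
qed

text \<open>The first conjunct identifies the colors over \<open>A\<close> through
  \<open>etaC\<close>, which justifies the relabelled legs in \<open>X\<close>. Leastness is
  initiality, and the isomorphism is \<open>s\<close> itself, that is, actual composition in
  \<open>D\<close>.\<close>

theorem proposition2p10:
  fixes S :: "('c, 'v) species" and P :: "('a, 'f) operad" and D :: "('d, 'p) operad"
    and phiC :: "'c \<Rightarrow> 'a" and phiV :: "'v \<Rightarrow> 'f"
    and etaC :: "'c \<Rightarrow> 'd" and etaV :: "'v \<Rightarrow> 'p"
    and pC :: "'d \<Rightarrow> 'a" and pV :: "'p \<Rightarrow> 'f"
  assumes "operad P"
    and "species_map S P phiC phiV"
    and "free_operad S D etaC etaV"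
    and "operad_functor D P pC pV"
    and "extends_along S etaC etaV pC pV phiC phiV"
  defines "F \<equiv> fiber D pC pV"
  defines "X \<equiv> relabel (inv_into (colors S) etaC) F"
  defines "s \<equiv> interpret_formal phiC etaC etaV F"
  shows "(\<forall>A\<in>colors P. bij_betw etaC (color_fiber S phiC A) (on_color F A)) \<and>
    initial_algebra TYPE('y) S P phiC phiV X s \<and>
    span_iso P (rhs S P phiC phiV X) X s \<and>
    (\<forall>c. constant_op P c \<longrightarrow>
       (id_summand S P phiC c :: ('c, 'v, 'f, 'p) formal set) = {} \<and>
       bij_betw (s c) (constant_summand S P phiV X c) (apex X c))"
proof -
  interpret tree_family S P phiC phiV X s "eval_tree D etaC etaV"
    unfolding X_def s_def F_def using assms(1-5) by (rule tree_family_fiber)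
  have "bij_betw etaC (color_fiber S phiC A) (on_color F A)" for A
    using bij_betw_restrict[OF free_operad_bij(1)[OF assms(3)], of pC phiC A] assms(5)
    by (simp add: F_def fiber_def color_fiber_def extends_along_def)
  moreover have "bij_betw (s c) (constant_summand S P phiV X c) (apex X c)"
    if c: "constant_op P c" for c
  proof -
    have "apex (rhs S P phiC phiV X) c = constant_summand S P phiV X c"
      by (simp add: rhs_def P.id_summand_constant[OF c] P.comp_summand_constant[OF c])
    then show ?thesis
      using span_iso_s c by (auto simp: span_iso_def constant_op_def)
  qed
  ultimately show ?thesis
    using initial_algebra_s span_iso_s by (simp add: P.id_summand_constant)
qed

end
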